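(* Let $G$ be a first countable Hausdorff topological group, let $H$ be a dense countable subgroup of $G$, let $(X,d)$ be a compact metric space, and let $\Phi\in\operatorname{Act}(G,X)$. If $\Phi$ is equicontinuous, then $\mathsf{M}_{AP}(\Phi)\subseteq\mathsf{M}_P(\Phi)$, i.e. every almost $\beta$-persistent measure is a $\beta$-persistent measure (with respect to $H$ and $\Phi$).
   Context: $\operatorname{Act}(G,X)$ denotes the set of all continuous maps $\Phi:G\times X\to X$ such that, writing $\Phi_g=\Phi(g,\cdot)$, each $\Phi_g$ is a homeomorphism of $X$, $\Phi_e=\mathrm{id}_X$ for the identity $e\in G$, and $\Phi_g\circ\Phi_h=\Phi_{gh}$ for all $g,h\in G$. For $\Phi,\Psi\in\operatorname{Act}(G,X)$ put $d_H(\Phi,\Psi)=\sup_{h\in H,\,x\in X} d(\Phi_h(x),\Psi_h(x))$. $\Phi$ is equicontinuous (with respect to $H$) if for each $\epsilon>0$ there is $\delta>0$ such that $x,y\in X$ and $d(x,y)\le\delta$ imply $d(\Phi_h(x),\Phi_h(y))\le\epsilon$ for each $h\in H$. A point $x\in X$ is a $\beta$-persistent point of $\Phi$ (with respect to $H$) if for each $\epsilon>0$ there is $\delta>0$ such that for each $\Psi\in\operatorname{Act}(G,X)$ with $d_H(\Phi,\Psi)\le\delta$ there is $y\in X$ with $d(\Phi_g(x),\Psi_g(y))\le\epsilon$ for each $g\in G$. $P(\Phi)$ is the set of all $\beta$-persistent points of $\Phi$ (a Borel set). For $\epsilon>0$ and $x\in X$ let $\Gamma_\epsilon^x(\Phi,\Psi)=\{y\in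 X\mid d(\Phi_g(x),\Psi_g(y))\le\epsilon\text{ for each }g\in G\}$ and $B(\epsilon,\Phi,\Psi)=\{x\in X\mid\Gamma_\epsilon^x(\Phi,\Psi)\ne\emptyset\}$ (a closed subset of $X$). $\mathcal{M}(X)$ is the set of Borel probability measures on $X$. A measure $\mu\in\mathcal{M}(X)$ is a $\beta$-persistent measure (with respect to $H$ and $\Phi$) if for each $\epsilon>0$ there is $\delta>0$ such that $\mu(B(\epsilon,\Phi,\Psi))=1$ for each $\Psi\in\operatorname{Act}(G,X)$ with $d_H(\Phi,\Psi)\le\delta$; $\mathsf{M}_P(\Phi)$ is the set of all such measures. A measure $\mu\in\mathcal{M}(X)$ is an almost $\beta$-persistent measure if $\mu(P(\Phi))=1$; $\mathsf{M}_{AP}(\Phi)$ is the set of all such measures. *)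

theory Defs
  imports "HOL-Analysis.Analysis" "HOL-Probability.Probability"
begin

text \<open>
  Groups are elements of the class of topological groups, which the library writes additively but
  does not assume to be commutative: the product \<open>gh\<close> is \<open>g + h\<close>, the identity \<open>e\<close> is \<open>0\<close>.
\<close>

definition is_subgroup :: "'g::group_add set \<Rightarrow> bool" where
  "is_subgroup H \<longleftrightarrow> 0 \<in> H \<and> (\<forall>g\<in>H. \<forall>h\<in>H. g + h \<in> H) \<and> (\<forall>g\<in>H. - g \<in> H)"

definition Act :: "('g::topological_group_add \<Rightarrow> 'x::metric_space \<Rightarrow> 'x) set" where
  "Act = {\<Phi>. continuous_on UNIV (\<lambda>(g, x). \<Phi> g x)
            \<and> (\<forall>g. \<exists>\<psi>. homeomorphism UNIV UNIV (\<Phi> g) \<psi>)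
            \<and> \<Phi> 0 = id
            \<and> (\<forall>g h. \<Phi> g \<circ> \<Phi> h = \<Phi> (g + h))}"

text \<open>
  The supremum below is taken in the reals. It is the intended one when \<open>X\<close> is compact and \<open>H\<close> is
  nonempty, since the set of distances is then bounded and nonempty.
\<close>

definition dist_act ::
  "'g set \<Rightarrow> ('g \<Rightarrow> 'x::metric_space \<Rightarrow> 'x) \<Rightarrow> ('g \<Rightarrow> 'x \<Rightarrow> 'x) \<Rightarrow> real" where
  "dist_act H \<Phi> \<Psi> = (SUP (h, x)\<in>H \<times> UNIV. dist (\<Phi> h x) (\<Psi> h x))"

definition equicontinuous_act :: "'g set \<Rightarrow> ('g \<Rightarrow> 'x::metric_space \<Rightarrow> 'x) \<Rightarrow> bool" where
  "equicontinuous_act H \<Phi> \<longleftrightarrow>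
     (\<forall>\<epsilon>>0. \<exists>\<delta>>0. \<forall>x y. dist x y \<le> \<delta> \<longrightarrow> (\<forall>h\<in>H. dist (\<Phi> h x) (\<Phi> h y) \<le> \<epsilon>))"

definition beta_persistent_point ::
  "'g::topological_group_add set \<Rightarrow> ('g \<Rightarrow> 'x::metric_space \<Rightarrow> 'x) \<Rightarrow> 'x \<Rightarrow> bool" where
  "beta_persistent_point H \<Phi> x \<longleftrightarrow>
     (\<forall>\<epsilon>>0. \<exists>\<delta>>0. \<forall>\<Psi>\<in>Act. dist_act H \<Phi> \<Psi> \<le> \<delta> \<longrightarrow>
        (\<exists>y. \<forall>g. dist (\<Phi> g x) (\<Psi> g y) \<le> \<epsilon>))"

definition persistent_points ::
  "'g::topological_group_add set \<Rightarrow> ('g \<Rightarrow> 'x::metric_space \<Rightarrow> 'x) \<Rightarrow> 'x set" where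
  "persistent_points H \<Phi> = {x. beta_persistent_point H \<Phi> x}"

definition shadow_set ::
  "real \<Rightarrow> ('g \<Rightarrow> 'x::metric_space \<Rightarrow> 'x) \<Rightarrow> ('g \<Rightarrow> 'x \<Rightarrow> 'x) \<Rightarrow> 'x \<Rightarrow> 'x set" where
  "shadow_set \<epsilon> \<Phi> \<Psi> x = {y. \<forall>g. dist (\<Phi> g x) (\<Psi> g y) \<le> \<epsilon>}"

definition shadowable_points ::
  "real \<Rightarrow> ('g \<Rightarrow> 'x::metric_space \<Rightarrow> 'x) \<Rightarrow> ('g \<Rightarrow> 'x \<Rightarrow> 'x) \<Rightarrow> 'x set" where
  "shadowable_points \<epsilon> \<Phi> \<Psi> = {x. shadow_set \<epsilon> \<Phi> \<Psi> x \<noteq> {}}"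

definition borel_prob_measures :: "'x::topological_space measure set" where
  "borel_prob_measures = {\<mu>. prob_space \<mu> \<and> sets \<mu> = sets borel}"

text \<open>
  \<open>measure \<mu> A\<close> is \<open>0\<close> for non-measurable \<open>A\<close>, so each equation \<open>measure \<mu> A = 1\<close> below also
  asserts that \<open>A\<close> is Borel.
\<close>

definition persistent_measures ::
  "'g::topological_group_add set \<Rightarrow> ('g \<Rightarrow> 'x::metric_space \<Rightarrow> 'x) \<Rightarrow> 'x measure set" where
  "persistent_measures H \<Phi> =
     {\<mu>\<in>borel_prob_measures.
        \<forall>\<epsilon>>0. \<exists>\<delta>>0. \<forall>\<Psi>\<in>Act. dist_act H \<Phi> \<Psi> \<le> \<delta> \<longrightarrow>
          measure \<mu> (shadowable_points \<epsilon> \<Phi> \<Psi>) = 1}"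

definition almost_persistent_measures ::
  "'g::topological_group_add set \<Rightarrow> ('g \<Rightarrow> 'x::metric_space \<Rightarrow> 'x) \<Rightarrow> 'x measure set" where
  "almost_persistent_measures H \<Phi> =
     {\<mu>\<in>borel_prob_measures. measure \<mu> (persistent_points H \<Phi>) = 1}"

end

theory Submission
  imports Defs
begin

text \<open>
  By density of \<open>H\<close>, equicontinuity holds along the whole group, so points close to an
  \<open>\<epsilon>/2\<close>-shadowed point are \<open>\<epsilon>\<close>-shadowed by the same orbit. Covering the totally bounded set
  of persistent points by finitely many balls centred in it, one \<open>\<delta>\<close> serves all persistent points
  at once. The set of shadowable points is a projection of a compact set, hence Borel, and it
  contains a set of full measure.
\<close>

lemma Act_continuous_point:
  assumes "\<Phi> \<in> Act"
  shows "continuous_on UNIV (\<Phi> g)"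
  using assms by (auto simp: Act_def homeomorphism_def)

lemma Act_continuous_group:
  assumes "\<Phi> \<in> Act"
  shows "continuous_on UNIV (\<lambda>g. \<Phi> g x)"
proof -
  have "continuous_on UNIV (\<lambda>(g, x). \<Phi> g x)"
    using assms by (simp add: Act_def)
  then have "continuous_on UNIV (\<lambda>g. (\<lambda>(g, x). \<Phi> g x) (g, x))"
    by (rule continuous_on_compose2) (auto intro: continuous_intros)
  then show ?thesis by simp
qed

text \<open>For fixed \<open>x\<close> and \<open>y\<close> the bound is a closed condition on
  \<open>g\<close>, because orbit maps are continuous, so it passes from \<open>H\<close> to its
  closure with the same \<delta>. This is needed because shadowing quantifies over every group
  element.\<close>

lemma equicontinuous_act_closure:
  assumes "\<Phi> \<in> Act" and "equicontinuous_act H \<Phi>"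
  shows "equicontinuous_act (closure H) \<Phi>"
  unfolding equicontinuous_act_def
proof (intro allI impI)
  fix \<epsilon> :: real
  assume "\<epsilon> > 0"
  then obtain \<delta> where "\<delta> > 0"
    and \<delta>: "\<And>x y h. dist x y \<le> \<delta> \<Longrightarrow> h \<in> H \<Longrightarrow> dist (\<Phi> h x) (\<Phi> h y) \<le> \<epsilon>"
    using assms(2) unfolding equicontinuous_act_def by meson
  have "closure H \<subseteq> {g. dist (\<Phi> g x) (\<Phi> g y) \<le> \<epsilon>}" if "dist x y \<le> \<delta>" for x y
  proof (rule closure_minimal)
    show "closed {g. dist (\<Phi> g x) (\<Phi> g y) \<le> \<epsilon>}"
      by (intro closed_Collect_le continuous_intros Act_continuous_group assms)
  qed (use \<delta> that in auto)
  with \<open>\<delta> > 0\<close>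
  show "\<exists>\<delta>>0. \<forall>x y. dist x y \<le> \<delta> \<longrightarrow> (\<forall>h\<in>closure H. dist (\<Phi> h x) (\<Phi> h y) \<le> \<epsilon>)"
    by blast
qed

text \<open>The pairs (x, y) such that y shadows x satisfy one closed condition for each
  \<open>g\<close>, hence form a compact subset of the square, and its projection is compact. This
  supplies measurability.\<close>

lemma closed_shadowable_points:
  fixes \<Phi> \<Psi> :: "'g::topological_group_add \<Rightarrow> 'x::metric_space \<Rightarrow> 'x"
  assumes "compact (UNIV :: 'x set)" and "\<Phi> \<in> Act" and "\<Psi> \<in> Act"
  shows "closed (shadowable_points \<epsilon> \<Phi> \<Psi>)"
proof -
  let ?R = "{p. \<forall>g. dist (\<Phi> g (fst p)) (\<Psi> g (snd p)) \<le> \<epsilon>}"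
  have "continuous_on UNIV (\<lambda>p :: 'x \<times> 'x. \<Phi> g (fst p))"
    "continuous_on UNIV (\<lambda>p :: 'x \<times> 'x. \<Psi> g (snd p))" for g
    by (rule continuous_on_compose2[OF Act_continuous_point];
        use assms in \<open>auto intro: continuous_intros\<close>)+
  then have "closed ?R"
    by (intro closed_Collect_all closed_Collect_le continuous_intros)
  moreover have "compact (UNIV :: ('x \<times> 'x) set)"
    using compact_Times[OF assms(1) assms(1)] by simp
  ultimately have "compact ?R"
    using compact_Int_closed by fastforce
  then have "compact (fst ` ?R)"
    by (intro compact_continuous_image continuous_intros)
  moreover have "fst ` ?R = shadowable_points \<epsilon> \<Phi> \<Psi>"
    unfolding shadowable_points_def shadow_set_def image_def by auto
  ultimately show ?thesis
    by (simp add: compact_imp_closed)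
qed

text \<open>This makes \<delta> independent of the persistent point: equicontinuity lets finitely
  many of these points stand for all of them.\<close>

lemma persistent_points_subset_shadowable_points:
  fixes \<Phi> :: "'g::topological_group_add \<Rightarrow> 'x::metric_space \<Rightarrow> 'x"
  assumes "compact (UNIV :: 'x set)" and "equicontinuous_act UNIV \<Phi>" and "\<epsilon> > 0"
  shows "\<exists>\<delta>>0. \<forall>\<Psi>\<in>Act. dist_act H \<Phi> \<Psi> \<le> \<delta> \<longrightarrow>
    persistent_points H \<Phi> \<subseteq> shadowable_points \<epsilon> \<Phi> \<Psi>"
proof -
  let ?P = "persistent_points H \<Phi>"
  \<comment> \<open>One half of \<epsilon> pays for moving from a point to a nearby centre, the
    other for shadowing that centre.\<close>
  have "\<epsilon> / 2 > 0" using assms(3) by simp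
  then obtain r where "r > 0"
    and r: "\<And>x y g. dist x y \<le> r \<Longrightarrow> dist (\<Phi> g x) (\<Phi> g y) \<le> \<epsilon> / 2"
    using assms(2) unfolding equicontinuous_act_def by (meson UNIV_I)
  \<comment> \<open>Compactness is applied to the closure, which is still covered by balls of the
    fixed radius \<open>r\<close> centred in \<open>?P\<close> itself, so every chosen centre is
    persistent.\<close>
  have "compact (closure ?P)"
    using compact_Int_closed[OF assms(1) closed_closure] by simp
  moreover have "closure ?P \<subseteq> (\<Union>p\<in>?P. ball p r)"
    using \<open>r > 0\<close> by (force simp: closure_approachable)
  ultimately obtain F where F: "F \<subseteq> ?P" "finite F" "closure ?P \<subseteq> (\<Union>p\<in>F. ball p r)"
    using compactE_image[of "closure ?P" ?P "\<lambda>p. ball p r"] by blast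
  have "\<forall>p\<in>F. \<exists>\<delta>>0. \<forall>\<Psi>\<in>Act. dist_act H \<Phi> \<Psi> \<le> \<delta> \<longrightarrow>
      (\<exists>y. \<forall>g. dist (\<Phi> g p) (\<Psi> g y) \<le> \<epsilon> / 2)"
    using F(1) \<open>\<epsilon> / 2 > 0\<close> unfolding persistent_points_def beta_persistent_point_def
    by blast
  then obtain d where d: "\<And>p. p \<in> F \<Longrightarrow> d p > 0"
    and shadow: "\<And>p \<Psi>. p \<in> F \<Longrightarrow> \<Psi> \<in> Act \<Longrightarrow> dist_act H \<Phi> \<Psi> \<le> d p \<Longrightarrow>
      \<exists>y. \<forall>g. dist (\<Phi> g p) (\<Psi> g y) \<le> \<epsilon> / 2"
    by metis
  \<comment> \<open>The extra 1 keeps the minimum meaningful and positive when \<open>F\<close> is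
    empty, that is, when there are no persistent points.\<close>
  define \<delta> where "\<delta> = Min (insert 1 (d ` F))"
  have "\<delta> > 0" using F(2) d by (auto simp: \<delta>_def)
  have \<delta>_le: "\<delta> \<le> d p" if "p \<in> F" for p
    using F(2) that by (simp add: \<delta>_def)
  have "x \<in> shadowable_points \<epsilon> \<Phi> \<Psi>"
    if \<Psi>: "\<Psi> \<in> Act" "dist_act H \<Phi> \<Psi> \<le> \<delta>" and x: "x \<in> ?P" for \<Psi> x
  proof -
    have "x \<in> (\<Union>p\<in>F. ball p r)"
      using F(3) closure_subset x by blast
    then obtain p where p: "p \<in> F" "dist x p \<le> r"
      by (auto simp: dist_commute less_imp_le)
    \<comment> \<open>The shadowing point of the centre \<open>p\<close> also serves
      \<open>x\<close>.\<close>
    obtain y where y: "\<And>g. dist (\<Phi> g p) (\<Psi> g y) \<le> \<epsilon> / 2"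
      using shadow[OF p(1) \<Psi>(1)] order_trans[OF \<Psi>(2) \<delta>_le[OF p(1)]] by blast
    have "dist (\<Phi> g x) (\<Psi> g y) \<le> \<epsilon>" for g
      using dist_triangle[of "\<Phi> g x" "\<Psi> g y" "\<Phi> g p"] r[OF p(2), of g] y[of g] by linarith
    then show ?thesis
      by (auto simp: shadowable_points_def shadow_set_def)
  qed
  with \<open>\<delta> > 0\<close> show ?thesis by blast
qed

theorem lemma3p20:
  fixes H :: "'g::{topological_group_add, first_countable_topology, t2_space} set"
    and \<Phi> :: "'g \<Rightarrow> 'x::metric_space \<Rightarrow> 'x"
  assumes "is_subgroup H" and "countable H" and "closure H = UNIV"
    and "compact (UNIV :: 'x set)"
    and "\<Phi> \<in> Act"
    and "equicontinuous_act H \<Phi>"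
  shows "almost_persistent_measures H \<Phi> \<subseteq> persistent_measures H \<Phi>"
proof
  fix \<mu>
  assume "\<mu> \<in> almost_persistent_measures H \<Phi>"
  then have \<mu>: "\<mu> \<in> borel_prob_measures" and full: "measure \<mu> (persistent_points H \<Phi>) = 1"
    by (auto simp: almost_persistent_measures_def)
  interpret prob_space \<mu> using \<mu> by (simp add: borel_prob_measures_def)
  have equi: "equicontinuous_act UNIV \<Phi>"
    using equicontinuous_act_closure[OF assms(5,6)] assms(3) by simp
  have "prob (shadowable_points \<epsilon> \<Phi> \<Psi>) = 1"
    if "\<Psi> \<in> Act" "persistent_points H \<Phi> \<subseteq> shadowable_points \<epsilon> \<Phi> \<Psi>" for \<epsilon> \<Psi>
  proof -
    \<comment> \<open>Monotonicity of the measure requires the larger set to be an event.\<close>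
    have "shadowable_points \<epsilon> \<Phi> \<Psi> \<in> events"
      using closed_shadowable_points[OF assms(4,5) that(1)] \<mu>
      by (simp add: borel_prob_measures_def)
    from finite_measure_mono[OF that(2) this] show ?thesis
      using full prob_le_1 by (simp add: order_antisym)
  qed
  then show "\<mu> \<in> persistent_measures H \<Phi>"
    using persistent_points_subset_shadowable_points[OF assms(4) equi, where H = H] \<mu>
    unfolding persistent_measures_def by blast
qed

end
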